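(* Let $n\ge 1$. As maps from $\mathcal{S}_n(132)$ to $\mathcal{D}_n$, $$\kappa=\psi\circ\Phi\circ\rho,$$ where $\kappa:\mathcal{S}_n(132)\to\mathcal{D}_n$ is Krattenthaler's bijection, $\Phi:\mathcal{S}_n(231)\to\mathcal{D}_n$, $\rho$ is the reversal of permutations, and $\psi:\mathcal{D}_n\to\mathcal{D}_n$ is the map on Dyck paths, all as defined in the context.
   Context: $\mathcal{S}_n$ is the symmetric group on $[n]=\{1,\dots,n\}$. $\mathcal{S}_n(132)$ is the set of $\sigma\in\mathcal{S}_n$ with no $i<j<k$ satisfying $\sigma_i<\sigma_k<\sigma_j$; $\mathcal{S}_n(231)$ is the set of $\sigma\in\mathcal{S}_n$ with no $i<j<k$ satisfying $\sigma_k<\sigma_i<\sigma_j$. $\rho([\sigma_1,\dots,\sigma_n])=[\sigma_n,\dots,\sigma_1]$, which maps $\mathcal{S}_n(132)$ onto $\mathcal{S}_n(231)$. $\operatorname{Des}(\sigma)=\{i : 1\le i<n,\ \sigma_i>\sigma_{i+1}\}$ and $\operatorname{iDes}(\sigma)=\operatorname{Des}(\sigma^{-1})$. A Dyck path of semilength $n$ is a word $D=D_1\cdots D_{2n}$ with $n$ letters $0$ (north steps) and $n$ letters $1$ (east steps) such that every prefix contains at least as many $0$'s as $1$'s; $\mathcal{D}_n$ is the set of these. A valley of $D$ is an $i$ with $D_i=1$, $D_{i+1}=0$; its coordinates are $(x,y)$ with $x$ the number of $1$'s and $y$ the number of $0$'s among $D_1,\dots,D_i$. $\operatorname{Set}_X(D)$,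 $\operatorname{Set}_Y(D)$ are the sets of $x$- and $y$-coordinates of the valleys of $D$; $D$ is uniquely determined by these two sets. The height of $D$ at position $i$ is the number of $0$'s minus the number of $1$'s among $D_1,\dots,D_i$. $\Phi$: for $\sigma\in\mathcal{S}_n(231)$ the sets $\operatorname{Des}(\sigma)=\{i_1<\dots<i_k\}$ and $\operatorname{iDes}(\sigma)=\{i'_1<\dots<i'_k\}$ have the same cardinality; with $i_{k+1}=i'_{k+1}=n$, $\Phi(\sigma)$ is the Dyck path consisting of $i'_1$ $0$'s, then $i_1$ $1$'s, then $i'_2-i'_1$ $0$'s, then $i_2-i_1$ $1$'s, and so on, ending with $i'_{k+1}-i'_k$ $0$'s and $i_{k+1}-i_k$ $1$'s (for $k=0$ it is $0^n1^n$). $\kappa$: for $\sigma\in\mathcal{S}_n(132)$ let $h_i$ be the number of $j>i$ with $\sigma_j>\sigma_i$. Read $\sigma$ from left to right and successively generate a Dyck path: when $\sigma_i$ is read, adjoin as many north steps as necessary, followed by an east step from height $h_i+1$ to height $h_i$. The resulting path is $\kappa(\sigma)$. $\psi$: let $\Psi:\mathcal{D}_n\to\mathcal{D}_n$ be the involution sending $D$ to the unique Dyck path $D'$ with $\operatorname{Set}_X(D')=[n-1]\setminus\operatorname{Set}_Y(D)$ and $\operatorname{Set}_Y(D')=[n-1]\setminus\operatorname{Set}_X(D)$. Then $\psi$ is $\Psi$ followed by the involution sending a Dyck path with valleys $\{(i_1,j_1),\dots,(i_k,j_k)\}$ to the Dyck path with valleys $\{(n-j_k,n-i_k),\dots,(n-j_1,n-i_1)\}$.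 *)

theory Defs
  imports "HOL-Combinatorics.Permutations" "HOL-Library.FuncSet"
begin

section \<open>Permutations\<close>

text \<open>
  A permutation of \<open>{1..n}\<close> is a function \<open>\<sigma> :: nat \<Rightarrow> nat\<close> with \<open>\<sigma> permutes {1..n}\<close>; in particular
  \<open>\<sigma>\<close> is the identity outside \<open>{1..n}\<close>, so that equality of permutations is equality of functions
  and \<open>inv \<sigma>\<close> is again a permutation of \<open>{1..n}\<close>.
\<close>

definition S132 :: "nat \<Rightarrow> (nat \<Rightarrow> nat) set" where
  "S132 n = {\<sigma>. \<sigma> permutes {1..n} \<and>
     \<not> (\<exists>i j k. 1 \<le> i \<and> i < j \<and> j < k \<and> k \<le> n \<and> \<sigma> i < \<sigma> k \<and> \<sigma> k < \<sigma> j)}"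

definition S231 :: "nat \<Rightarrow> (nat \<Rightarrow> nat) set" where
  "S231 n = {\<sigma>. \<sigma> permutes {1..n} \<and>
     \<not> (\<exists>i j k. 1 \<le> i \<and> i < j \<and> j < k \<and> k \<le> n \<and> \<sigma> k < \<sigma> i \<and> \<sigma> i < \<sigma> j)}"

definition rho :: "nat \<Rightarrow> (nat \<Rightarrow> nat) \<Rightarrow> nat \<Rightarrow> nat" where
  "rho n \<sigma> = (\<lambda>i. if i \<in> {1..n} then \<sigma> (n + 1 - i) else i)"

definition Des :: "nat \<Rightarrow> (nat \<Rightarrow> nat) \<Rightarrow> nat set" where
  "Des n \<sigma> = {i. 1 \<le> i \<and> i < n \<and> \<sigma> i > \<sigma> (i + 1)}"

definition iDes :: "nat \<Rightarrow> (nat \<Rightarrow> nat) \<Rightarrow> nat set" where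
  "iDes n \<sigma> = Des n (inv \<sigma>)"

section \<open>Dyck paths\<close>

text \<open>
  Words are lists over \<open>{0, 1}\<close> (\<open>0\<close> a north step, \<open>1\<close> an east step). List indices start at \<open>0\<close>, so
  the letter \<open>D\<^sub>i\<close> is \<open>D ! (i - 1)\<close> and \<open>D\<^sub>1 \<dots> D\<^sub>i\<close> is \<open>take i D\<close>.
\<close>

definition height :: "nat list \<Rightarrow> nat \<Rightarrow> int" where
  "height D i = int (count_list (take i D) 0) - int (count_list (take i D) 1)"

definition dyck :: "nat \<Rightarrow> nat list set" where
  "dyck n = {D. set D \<subseteq> {0, 1} \<and> count_list D 0 = n \<and> count_list D 1 = n \<and>
     (\<forall>i \<le> length D. count_list (take i D) 1 \<le> count_list (take i D) 0)}"

definition valleys :: "nat list \<Rightarrow> (nat \<times> nat) set" where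
  "valleys D = {(count_list (take i D) 1, count_list (take i D) 0) | i.
     1 \<le> i \<and> i < length D \<and> D ! (i - 1) = 1 \<and> D ! i = 0}"

definition SetX :: "nat list \<Rightarrow> nat set" where
  "SetX D = fst ` valleys D"

definition SetY :: "nat list \<Rightarrow> nat set" where
  "SetY D = snd ` valleys D"

section \<open>The maps between permutations and Dyck paths\<close>

text \<open>\<open>diffs [a\<^sub>1, a\<^sub>2, \<dots>, a\<^sub>m] = [a\<^sub>1, a\<^sub>2 - a\<^sub>1, \<dots>, a\<^sub>m - a\<^sub>m\<^sub>-\<^sub>1]\<close>\<close>

definition diffs :: "nat list \<Rightarrow> nat list" where
  "diffs xs = map2 (-) xs (0 # xs)"

text \<open>
  The two lists zipped here have the same length because \<open>Des n \<sigma>\<close> and \<open>iDes n \<sigma>\<close> have the same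
  cardinality for \<open>\<sigma> \<in> S231 n\<close>. Elsewhere the value is irrelevant.
\<close>

definition Phi :: "nat \<Rightarrow> (nat \<Rightarrow> nat) \<Rightarrow> nat list" where
  "Phi n \<sigma> = concat (map2 (\<lambda>a b. replicate a 0 @ replicate b 1)
     (diffs (sorted_list_of_set (iDes n \<sigma>) @ [n]))
     (diffs (sorted_list_of_set (Des n \<sigma>) @ [n])))"

definition hseq :: "nat \<Rightarrow> (nat \<Rightarrow> nat) \<Rightarrow> nat \<Rightarrow> nat" where
  "hseq n \<sigma> i = card {j. i < j \<and> j \<le> n \<and> \<sigma> j > \<sigma> i}"

text \<open>
  Extend \<open>w\<close> by the north steps needed to reach height \<open>h + 1\<close>, then by an east step from height
  \<open>h + 1\<close> to height \<open>h\<close>. The current height of \<open>w\<close> is at most \<open>h + 1\<close> at every step when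
  \<open>\<sigma> \<in> S132 n\<close>, so \<open>nat\<close> truncates nothing there.
\<close>

definition kappa_step :: "nat list \<Rightarrow> nat \<Rightarrow> nat list" where
  "kappa_step w h = w @ replicate (nat (int h + 1 - height w (length w))) 0 @ [1]"

definition kappa :: "nat \<Rightarrow> (nat \<Rightarrow> nat) \<Rightarrow> nat list" where
  "kappa n \<sigma> = foldl (\<lambda>w i. kappa_step w (hseq n \<sigma> i)) [] [1..<n + 1]"

definition Psi :: "nat \<Rightarrow> nat list \<Rightarrow> nat list" where
  "Psi n D = (THE D'. D' \<in> dyck n \<and>
     SetX D' = {1..n - 1} - SetY D \<and> SetY D' = {1..n - 1} - SetX D)"

definition flip_valleys :: "nat \<Rightarrow> nat list \<Rightarrow> nat list" where
  "flip_valleys n D = (THE D'. D' \<in> dyck n \<and> valleys D' = (\<lambda>(i, j). (n - j, n - i)) ` valleys D)"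

definition psi :: "nat \<Rightarrow> nat list \<Rightarrow> nat list" where
  "psi n = flip_valleys n \<circ> Psi n"

end

theory Submission
  imports Defs
begin

text \<open>
  A Dyck path is determined by its sets \<open>X\<close> and \<open>Y\<close> of valley coordinates (\<open>dyck_eqI\<close>), and the pairs
  \<open>(X, Y)\<close> that occur are exactly those satisfying the counting condition \<open>dyck_pair\<close>
  (\<open>dyck_pair_valleys\<close>, \<open>valley_path_dyck\<close>). In these terms \<open>\<psi>\<close> replaces each of \<open>X\<close> and \<open>Y\<close> by the
  complement of its reflection under \<open>i \<mapsto> n - i\<close> (\<open>psi_dyck\<close>), because the two complementations in
  \<open>\<Psi>\<close> exchange the coordinates and the second involution exchanges them back. Hence \<open>\<psi>\<close> is an
  involution (\<open>psi_psi\<close>).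

  For \<open>\<sigma>\<close> avoiding 132, reading \<open>\<sigma>\<^sub>i\<close> ends at the point \<open>(i, i + h\<^sub>i)\<close>. If \<open>\<sigma>\<close> has an ascent at \<open>i\<close>,
  avoidance forces \<open>h\<^sub>i = h\<^sub>i\<^sub>+\<^sub>1 + 1\<close> and no north step follows; at a descent \<open>h\<^sub>i \<le> h\<^sub>i\<^sub>+\<^sub>1\<close>, and there is
  a valley. So the valleys of \<open>\<kappa>(\<sigma>)\<close> are the points \<open>(i, i + h\<^sub>i)\<close> with \<open>i\<close> a descent. Moreover
  \<open>n - i - h\<^sub>i\<close> is the number \<open>c\<^sub>i\<close> of smaller values to the right of position \<open>i\<close>. Since 132 is
  avoided, these values are the smallest ones, \<open>1, \<dots>, c\<^sub>i\<close>; this yields that \<open>i \<mapsto> c\<^sub>i\<close> maps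
  \<open>Des \<sigma>\<close> onto \<open>iDes \<sigma>\<close>. Thus \<open>\<kappa>(\<sigma>)\<close> has \<open>x\<close>-coordinates \<open>Des \<sigma>\<close> and \<open>y\<close>-coordinates
  \<open>n - iDes \<sigma>\<close> (\<open>SetX_kappa\<close>, \<open>SetY_kappa\<close>).

  Reversal turns \<open>Des\<close> into the complement of its reflection and \<open>iDes\<close> into its complement
  (\<open>Des_rho\<close>, \<open>iDes_rho\<close>), so \<open>\<psi>(\<kappa>(\<sigma>))\<close> is the Dyck path with coordinate sets \<open>Des (\<rho>(\<sigma>))\<close> and
  \<open>iDes (\<rho>(\<sigma>))\<close>, that is, \<open>\<Phi>(\<rho>(\<sigma>))\<close> (\<open>Phi_rho\<close>). This shows in passing that \<open>\<Phi>\<close> takes values in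
  Dyck paths, and applying the involution \<open>\<psi>\<close> once more gives the theorem.
\<close>

section \<open>Words, ballot condition and valleys\<close>

text \<open>
  The prefix condition for Dyck paths, phrased with concatenations instead of positions; valleys are
  treated in the same way in \<open>valleys_iff\<close>.
\<close>

definition ballot :: "nat list \<Rightarrow> bool" where
  "ballot w \<longleftrightarrow> (\<forall>p q. w = p @ q \<longrightarrow> count_list p 1 \<le> count_list p 0)"

lemma ballot_count: "ballot w \<Longrightarrow> count_list w 1 \<le> count_list w 0"
  unfolding ballot_def by (metis append_Nil2)

lemma ballot_snoc:
  "ballot (w @ [a]) \<longleftrightarrow> ballot w \<and> count_list (w @ [a]) 1 \<le> count_list (w @ [a]) 0"
proof
  assume "ballot (w @ [a])"
  then show "ballot w \<and> count_list (w @ [a]) 1 \<le> count_list (w @ [a]) 0"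
    using ballot_count unfolding ballot_def by (metis append_assoc)
next
  assume *: "ballot w \<and> count_list (w @ [a]) 1 \<le> count_list (w @ [a]) 0"
  show "ballot (w @ [a])"
    unfolding ballot_def
  proof (intro allI impI)
    fix p q assume "w @ [a] = p @ q"
    then show "count_list p 1 \<le> count_list p 0"
      using * by (cases q rule: rev_cases) (auto simp: ballot_def)
  qed
qed

lemma ballot_north: "ballot (w @ replicate a 0) \<longleftrightarrow> ballot w"
proof (induction a)
  case (Suc a)
  have "w @ replicate (Suc a) 0 = (w @ replicate a 0) @ [0]"
    by (simp add: replicate_append_same)
  then show ?case
    using Suc ballot_count[of "w @ replicate a 0"] by (auto simp only: ballot_snoc) auto
qed simp

lemma count_list_replicate: "count_list (replicate m a) b = (if a = b then m else 0)"
  by (induction m) auto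

lemma ballot_east:
  "ballot w \<Longrightarrow> count_list w 1 + b \<le> count_list w 0 \<Longrightarrow> ballot (w @ replicate b 1)"
proof (induction b)
  case (Suc b)
  have "w @ replicate (Suc b) 1 = (w @ replicate b 1) @ [1]"
    by (simp add: replicate_append_same)
  then show ?case
    using Suc by (simp only: ballot_snoc) (simp add: count_list_replicate)
qed simp

lemma dyck_iff:
  "D \<in> dyck n \<longleftrightarrow> set D \<subseteq> {0, 1} \<and> count_list D 0 = n \<and> count_list D 1 = n \<and> ballot D"
proof -
  have "(\<forall>i \<le> length D. count_list (take i D) 1 \<le> count_list (take i D) 0) \<longleftrightarrow> ballot D"
  proof
    assume *: "\<forall>i \<le> length D. count_list (take i D) 1 \<le> count_list (take i D) 0"
    show "ballot D"
      unfolding ballot_def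
    proof (intro allI impI)
      fix p q assume "D = p @ q"
      then show "count_list p 1 \<le> count_list p 0"
        using *[rule_format, of "length p"] by simp
    qed
  next
    assume "ballot D"
    then show "\<forall>i \<le> length D. count_list (take i D) 1 \<le> count_list (take i D) 0"
      unfolding ballot_def by (metis append_take_drop_id)
  qed
  then show ?thesis
    by (auto simp: dyck_def)
qed

lemma valleys_iff:
  "(x, y) \<in> valleys D \<longleftrightarrow>
     (\<exists>p r. D = p @ 1 # 0 # r \<and> x = Suc (count_list p 1) \<and> y = count_list p 0)"
proof
  assume "(x, y) \<in> valleys D"
  then obtain i where i: "1 \<le> i" "i < length D" "D ! (i - 1) = 1" "D ! i = 0"
    and xy: "x = count_list (take i D) 1" "y = count_list (take i D) 0"
    by (auto simp: valleys_def)
  obtain j where j: "i = Suc j"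
    using i(1) by (cases i) auto
  have tk: "take i D = take j D @ [1]"
    using i j by (simp add: take_Suc_conv_app_nth)
  have "D = take i D @ drop i D"
    by simp
  also have "drop i D = 0 # drop (Suc i) D"
    using i by (metis Cons_nth_drop_Suc)
  finally have "D = take j D @ 1 # 0 # drop (Suc i) D"
    using tk by simp
  then show "\<exists>p r. D = p @ 1 # 0 # r \<and> x = Suc (count_list p 1) \<and> y = count_list p 0"
    using xy tk by (intro exI[of _ "take j D"] exI[of _ "drop (Suc i) D"]) simp
next
  assume "\<exists>p r. D = p @ 1 # 0 # r \<and> x = Suc (count_list p 1) \<and> y = count_list p 0"
  then obtain p r where "D = p @ 1 # 0 # r" "x = Suc (count_list p 1)" "y = count_list p 0"
    by blast
  then show "(x, y) \<in> valleys D"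
    unfolding valleys_def
    by (auto intro!: exI[of _ "Suc (length p)"] simp: nth_append)
qed

lemma valleys_Nil [simp]: "valleys [] = {}"
  by (auto simp: valleys_def)

lemma valleys_snoc:
  "valleys (w @ [a]) = valleys w \<union>
     (if w \<noteq> [] \<and> last w = 1 \<and> a = 0 then {(count_list w 1, count_list w 0)} else {})"
proof -
  have "(x, y) \<in> valleys (w @ [a]) \<longleftrightarrow> (x, y) \<in> valleys w \<or>
      (w \<noteq> [] \<and> last w = 1 \<and> a = 0 \<and> x = count_list w 1 \<and> y = count_list w 0)" for x y
  proof
    assume "(x, y) \<in> valleys (w @ [a])"
    then obtain p r where *: "w @ [a] = p @ 1 # 0 # r"
      "x = Suc (count_list p 1)" "y = count_list p 0"
      by (auto simp: valleys_iff)
    show "(x, y) \<in> valleys w \<or>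
      (w \<noteq> [] \<and> last w = 1 \<and> a = 0 \<and> x = count_list w 1 \<and> y = count_list w 0)"
    proof (cases r rule: rev_cases)
      case Nil
      then have "w @ [a] = (p @ [1]) @ [0]"
        using * by simp
      then show ?thesis
        using * by auto
    next
      case (snoc r' b)
      then have "w @ [a] = (p @ 1 # 0 # r') @ [b]"
        using * by simp
      then show ?thesis
        using * by (auto simp: valleys_iff)
    qed
  next
    assume "(x, y) \<in> valleys w \<or>
      (w \<noteq> [] \<and> last w = 1 \<and> a = 0 \<and> x = count_list w 1 \<and> y = count_list w 0)"
    then show "(x, y) \<in> valleys (w @ [a])"
    proof
      assume "(x, y) \<in> valleys w"
      then show ?thesis
        by (fastforce simp: valleys_iff)
    next
      assume *: "w \<noteq> [] \<and> last w = 1 \<and> a = 0 \<and> x = count_list w 1 \<and> y = count_list w 0"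
      then obtain p where "w = p @ [1]"
        by (metis append_butlast_last_id)
      then show ?thesis
        using * by (auto simp: valleys_iff)
    qed
  qed
  then show ?thesis
    by (auto split: if_splits)
qed

lemma valleys_north:
  "valleys (w @ replicate a 0) = valleys w \<union>
     (if 0 < a \<and> w \<noteq> [] \<and> last w = 1 then {(count_list w 1, count_list w 0)} else {})"
proof (induction a)
  case (Suc a)
  have "w @ replicate (Suc a) 0 = (w @ replicate a 0) @ [0]"
    by (simp add: replicate_append_same)
  then have "valleys (w @ replicate (Suc a) 0) = valleys (w @ replicate a 0) \<union>
      (if w @ replicate a 0 \<noteq> [] \<and> last (w @ replicate a 0) = 1
       then {(count_list (w @ replicate a 0) 1, count_list (w @ replicate a 0) 0)} else {})"
    by (simp only: valleys_snoc) simp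
  then show ?case
    using Suc.IH by (cases "a = 0") (auto simp del: replicate_Suc)
qed simp

lemma valleys_east: "valleys (w @ replicate b 1) = valleys w"
proof (induction b)
  case (Suc b)
  have "w @ replicate (Suc b) 1 = (w @ replicate b 1) @ [1]"
    by (simp add: replicate_append_same)
  then show ?case
    using Suc by (simp only: valleys_snoc) simp
qed simp

text \<open>
  Of two distinct valleys one lies strictly to the lower left of the other: the later one is
  separated from the earlier one by at least one north and one east step. In particular both
  coordinate projections are injective on the set of valleys.
\<close>

lemma valleys_chain:
  "\<lbrakk>(x, y) \<in> valleys w; (x', y') \<in> valleys w\<rbrakk> \<Longrightarrow>
     x = x' \<and> y = y' \<or> x < x' \<and> y < y' \<or> x' < x \<and> y' < y"
proof (induction w rule: rev_induct)
  case (snoc a w)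
  have new: "u < count_list w 1 \<and> v < count_list w 0"
    if uv: "(u, v) \<in> valleys w" and last: "last w = 1" for u v
  proof -
    obtain p r where *: "w = p @ 1 # 0 # r" "u = Suc (count_list p 1)" "v = count_list p 0"
      using uv unfolding valleys_iff by blast
    have "r \<noteq> []"
      using * last by auto
    then obtain r' where "r = r' @ [1]"
      using last * by (cases r rule: rev_cases) auto
    then show ?thesis
      using * by simp
  qed
  show ?case
    using snoc.IH snoc.prems new by (auto simp: valleys_snoc split: if_splits)
qed simp

section \<open>Dyck paths and their valley coordinates\<close>

text \<open>
  The condition for \<open>X\<close> and \<open>Y\<close> to be the sets of \<open>x\<close>- and \<open>y\<close>-coordinates of the valleys of a Dyck
  path. Up to every bound \<open>t\<close> there are at least as many \<open>x\<close>-coordinates as \<open>y\<close>-coordinates. For sets of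
  equal size this says that the \<open>k\<close>-th smallest element of \<open>X\<close> is at most the \<open>k\<close>-th smallest element
  of \<open>Y\<close> for all \<open>k\<close>; the counting form is the one that passes easily to complements.
\<close>

definition dyck_pair :: "nat \<Rightarrow> nat set \<Rightarrow> nat set \<Rightarrow> bool" where
  "dyck_pair n X Y \<longleftrightarrow> X \<subseteq> {1..n - 1} \<and> Y \<subseteq> {1..n - 1} \<and> card X = card Y \<and>
     (\<forall>t. card (Y \<inter> {..t}) \<le> card (X \<inter> {..t}))"

lemma dyck_valley_bounds:
  assumes "D \<in> dyck n" "(x, y) \<in> valleys D"
  shows "1 \<le> x" "x \<le> y" "y < n"
proof -
  obtain p r where *: "D = p @ 1 # 0 # r" "x = Suc (count_list p 1)" "y = count_list p 0"
    using assms(2) by (auto simp: valleys_iff)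
  then have "D = (p @ [1]) @ 0 # r"
    by simp
  moreover have "ballot D"
    using assms(1) by (simp add: dyck_iff)
  ultimately have "count_list (p @ [1]) 1 \<le> count_list (p @ [1]) 0"
    unfolding ballot_def by blast
  then show "1 \<le> x" "x \<le> y"
    using * by auto
  show "y < n"
    using * assms(1) by (auto simp: dyck_iff)
qed

lemma dyck_pair_valleys:
  assumes D: "D \<in> dyck n"
  shows "dyck_pair n (SetX D) (SetY D)"
proof -
  have injX: "inj_on fst (valleys D)" and injY: "inj_on snd (valleys D)"
    using valleys_chain[of _ _ D] by (fastforce simp: inj_on_def)+
  have sub: "SetX D \<subseteq> {1..n - 1}" "SetY D \<subseteq> {1..n - 1}"
    using dyck_valley_bounds[OF D] by (fastforce simp: SetX_def SetY_def)+
  have fin: "finite (valleys D)"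
    using finite_imageD[OF finite_subset[OF sub(1)[unfolded SetX_def]] injX] by simp
  have "card (SetY D \<inter> {..t}) \<le> card (SetX D \<inter> {..t})" for t
  proof -
    have "SetY D \<inter> {..t} = snd ` {v \<in> valleys D. snd v \<le> t}"
      by (auto simp: SetY_def)
    then have "card (SetY D \<inter> {..t}) = card {v \<in> valleys D. snd v \<le> t}"
      using injY by (simp add: card_image inj_on_subset)
    also have "\<dots> \<le> card {v \<in> valleys D. fst v \<le> t}"
      using fin dyck_valley_bounds(2)[OF D] by (intro card_mono) fastforce+
    also have "\<dots> = card (fst ` {v \<in> valleys D. fst v \<le> t})"
      using injX by (simp add: card_image inj_on_subset)
    also have "fst ` {v \<in> valleys D. fst v \<le> t} = SetX D \<inter> {..t}"
      by (auto simp: SetX_def)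
    finally show ?thesis .
  qed
  then show ?thesis
    using sub injX injY by (simp add: dyck_pair_def SetX_def SetY_def card_image)
qed

text \<open>
  The two letters that form a valley \<open>(x, y)\<close> are the \<open>x\<close>-th letter \<open>1\<close> and the \<open>(y + 1)\<close>-st
  letter \<open>0\<close> of the word, so each coordinate alone locates the valley.
\<close>

lemma split_at_equal_count:
  "\<lbrakk>s @ a # t = u @ a # v; count_list s a = count_list u a\<rbrakk> \<Longrightarrow> s = u \<and> t = v"
proof (induction s arbitrary: u)
  case Nil
  then show ?case by (cases u) auto
next
  case (Cons b s)
  then show ?case by (cases u) (auto split: if_splits)
qed

text \<open>
  Two Dyck paths with the same valley coordinates cannot separate. At the origin neither can go
  east. After an east step, the path
  continuing north has a valley at the point \<open>P\<close> of separation, while the other path, which continues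
  east, has none with the \<open>x\<close>-coordinate of \<open>P\<close>. After a north step, the path continuing east
  has a valley with the \<open>y\<close>-coordinate of \<open>P\<close>, while the one continuing north has none.
\<close>

lemma dyck_first_difference:
  assumes D: "p @ 0 # r \<in> dyck n" and D': "p @ 1 # r' \<in> dyck n"
    and X: "SetX (p @ 0 # r) \<subseteq> SetX (p @ 1 # r')"
    and Y: "SetY (p @ 1 # r') \<subseteq> SetY (p @ 0 # r)"
  shows False
proof (cases p rule: rev_cases)
  case Nil
  then have "p @ 1 # r' = [1] @ r'"
    by simp
  moreover have "ballot (p @ 1 # r')"
    using D' by (simp add: dyck_iff)
  ultimately have "count_list [1::nat] 1 \<le> count_list [1::nat] 0"
    unfolding ballot_def by metis
  then show False by simp
next
  case (snoc u a)
  have "a = 0 \<or> a = 1"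
    using D snoc by (auto simp: dyck_iff)
  then show False
  proof
    assume a: "a = 1"
    have "(count_list p 1, count_list p 0) \<in> valleys (p @ 0 # r)"
      using a snoc by (auto simp: valleys_iff)
    then have "count_list p 1 \<in> SetX (p @ 1 # r')"
      using X by (force simp: SetX_def)
    then obtain s t where "p @ 1 # r' = s @ 1 # 0 # t" "count_list p 1 = Suc (count_list s 1)"
      by (auto simp: SetX_def valleys_iff)
    then show False
      using a snoc split_at_equal_count[of u 1 "1 # r'" s "0 # t"] by simp
  next
    assume a: "a = 0"
    \<comment> \<open>Both words contain \<open>n\<close> letters \<open>0\<close>, so the path continuing east turns north later;
      its next turn, before the first \<open>0\<close> of \<open>r'\<close>, is the valley sought.\<close>
    have "count_list r' 0 \<noteq> 0"
      using D D' by (auto simp: dyck_iff)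
    then have "0 \<in> set (1 # r')"
      by (auto simp: count_list_0_iff)
    then obtain q z where q: "1 # r' = q @ 0 # z" "0 \<notin> set q"
      by (meson split_list_first)
    have "q \<noteq> []"
      using q by auto
    then obtain q' b where b: "q = q' @ [b]"
      by (cases q rule: rev_cases) auto
    have "set q \<subseteq> set (1 # r')"
      unfolding q(1) by auto
    then have "set q \<subseteq> {0, 1}"
      using D' by (auto simp: dyck_iff)
    then have "b = 1"
      using b q(2) by auto
    then have "p @ 1 # r' = (p @ q') @ 1 # 0 # z" "count_list (p @ q') 0 = count_list p 0"
      using q b by (auto simp: count_list_0_iff)
    then have "(Suc (count_list (p @ q') 1), count_list p 0) \<in> valleys (p @ 1 # r')"
      unfolding valleys_iff by metis
    then have "count_list p 0 \<in> SetY (p @ 0 # r)"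
      using Y by (force simp: SetY_def)
    then obtain s t where "p @ 0 # r = s @ 1 # 0 # t" "count_list p 0 = count_list s 0"
      by (auto simp: SetY_def valleys_iff)
    then have "p = s @ [1]"
      using split_at_equal_count[of p 0 r "s @ [1]" t] by simp
    then show False
      using a snoc by simp
  qed
qed

lemma length_binary_word:
  "set w \<subseteq> {0, 1 :: nat} \<Longrightarrow> length w = count_list w 0 + count_list w 1"
  by (induction w) auto

lemma dyck_eqI:
  assumes D: "D \<in> dyck n" "D' \<in> dyck n"
    and eq: "SetX D = SetX D'" "SetY D = SetY D'"
  shows "D = D'"
proof (rule ccontr)
  assume "D \<noteq> D'"
  moreover have "length D = length D'"
    using D by (simp add: dyck_iff length_binary_word)
  ultimately obtain p a r b r' where
    ab: "a \<noteq> b" and "D = p @ [a] @ r" "D' = p @ [b] @ r'"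
    using same_length_different[of D D'] by blast
  then have p: "D = p @ a # r" "D' = p @ b # r'"
    by simp_all
  have "a \<in> {0, 1}" "b \<in> {0, 1}"
    using D p by (auto simp: dyck_iff)
  then consider "a = 0" "b = 1" | "a = 1" "b = 0"
    using ab by auto
  then show False
    using dyck_first_difference[of p r n r'] dyck_first_difference[of p r' n r] D eq p
    by cases auto
qed

section \<open>The path with prescribed valley coordinates\<close>

text \<open>
  The path whose peaks lie at the points \<open>(0, ys\<^sub>1), (xs\<^sub>1, ys\<^sub>2), \<dots>\<close>. Every entry of the lists but the
  last is a valley coordinate; the last entries give the end point of the path.
\<close>

definition stair :: "nat list \<Rightarrow> nat list \<Rightarrow> nat list" where
  "stair xs ys = concat (map2 (\<lambda>a b. replicate a 0 @ replicate b 1) (diffs ys) (diffs xs))"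

text \<open>
  The path from \<open>(0, 0)\<close> to \<open>(n, n)\<close> with the prescribed sets of valley coordinates.
\<close>

definition valley_path :: "nat \<Rightarrow> nat set \<Rightarrow> nat set \<Rightarrow> nat list" where
  "valley_path n X Y = stair (sorted_list_of_set X @ [n]) (sorted_list_of_set Y @ [n])"

lemma Phi_eq_valley_path: "Phi n \<sigma> = valley_path n (Des n \<sigma>) (iDes n \<sigma>)"
  by (simp add: Phi_def valley_path_def stair_def)

lemma diffs_snoc: "diffs (xs @ [x]) = diffs xs @ [x - last (0 # xs)]"
proof (rule nth_equalityI)
  fix k assume "k < length (diffs (xs @ [x]))"
  then have "k < length xs \<or> k = length xs"
    by (auto simp: diffs_def)
  then show "diffs (xs @ [x]) ! k = (diffs xs @ [x - last (0 # xs)]) ! k"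
  proof
    assume "k < length xs"
    then show ?thesis
      by (cases k) (auto simp: diffs_def nth_append nth_Cons')
  next
    assume "k = length xs"
    then show ?thesis
      by (cases xs rule: rev_cases) (auto simp: diffs_def nth_append nth_Cons')
  qed
qed (simp add: diffs_def)

lemma stair_snoc:
  assumes "length xs = length ys"
  shows "stair (xs @ [x]) (ys @ [y]) =
    (stair xs ys @ replicate (y - last (0 # ys)) 0) @ replicate (x - last (0 # xs)) 1"
proof -
  have "length (diffs xs) = length (diffs ys)"
    using assms by (simp add: diffs_def)
  then show ?thesis
    by (simp add: stair_def diffs_snoc del: last.simps)
qed

lemma stair_props:
  assumes "sorted_wrt (<) (0 # xs)" "sorted_wrt (<) (0 # ys)" "list_all2 (\<le>) xs ys"
  shows "set (stair xs ys) \<subseteq> {0, 1}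
    \<and> count_list (stair xs ys) 1 = last (0 # xs) \<and> count_list (stair xs ys) 0 = last (0 # ys)
    \<and> ballot (stair xs ys) \<and> (xs \<noteq> [] \<longrightarrow> stair xs ys \<noteq> [] \<and> last (stair xs ys) = 1)
    \<and> valleys (stair xs ys) = set (zip (butlast xs) (butlast ys))"
  using assms
proof (induction xs arbitrary: ys rule: rev_induct)
  case Nil
  then show ?case
    by (auto simp: stair_def diffs_def ballot_def)
next
  case (snoc x xs)
  obtain ys' y where ys: "ys = ys' @ [y]"
    using snoc.prems(3) by (cases ys rule: rev_cases) auto
  have len: "length xs = length ys'"
    using list_all2_lengthD[OF snoc.prems(3)] ys by simp
  have all2: "list_all2 (\<le>) xs ys'" "x \<le> y"
    using snoc.prems(3) ys len by (simp_all add: list_all2_append)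
  have so: "sorted_wrt (<) (0 # xs)" "sorted_wrt (<) (0 # ys')"
    using snoc.prems ys by (auto simp: sorted_wrt_append)
  have lt: "last (0 # xs) < x" "last (0 # ys') < y"
    using snoc.prems ys by (auto simp: sorted_wrt_append)
  let ?w = "stair xs ys'"
  note IH = snoc.IH[OF so all2(1)]
  have z: "zip xs ys' = (if xs = [] then [] else
      zip (butlast xs) (butlast ys') @ [(last xs, last ys')])"
    using len by (cases xs rule: rev_cases; cases ys' rule: rev_cases) auto
  have b: "ballot (?w @ replicate (y - last (0 # ys')) 0)"
    using IH by (simp add: ballot_north)
  have "ballot ((?w @ replicate (y - last (0 # ys')) 0) @ replicate (x - last (0 # xs)) 1)"
    using IH lt all2(2) by (intro ballot_east[OF b]) (simp add: count_list_replicate)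
  moreover have "ys' \<noteq> [] \<longleftrightarrow> xs \<noteq> []"
    using len by auto
  moreover have "xs = [] \<Longrightarrow> ?w = []"
    by (simp add: stair_def diffs_def)
  ultimately show ?case
    unfolding ys stair_snoc[OF len] valleys_east valleys_north butlast_snoc z
    using IH lt by (auto simp: count_list_replicate)
qed

lemma sorted_list_of_set_pointwise_le:
  fixes X Y :: "nat set"
  assumes fin: "finite X" "finite Y" and card: "card X = card Y"
    and le: "\<And>t. card (Y \<inter> {..t}) \<le> card (X \<inter> {..t})"
  shows "list_all2 (\<le>) (sorted_list_of_set X) (sorted_list_of_set Y)"
proof -
  define xs ys where "xs = sorted_list_of_set X" and "ys = sorted_list_of_set Y"
  have so: "sorted_wrt (<) xs" "sorted_wrt (<) ys" and st: "set xs = X" "set ys = Y"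
    and len: "length xs = card X" "length ys = card X"
    using fin card by (auto simp: xs_def ys_def)
  have "xs ! k \<le> ys ! k" if k: "k < card X" for k
  proof (rule ccontr)
    assume "\<not> xs ! k \<le> ys ! k"
    then have gt: "ys ! k < xs ! k"
      by simp
    have "distinct ys"
      using so by (simp add: strict_sorted_iff)
    then have "Suc k = card (set (take (Suc k) ys))"
      using k len by (simp add: distinct_card)
    also have "\<dots> \<le> card (Y \<inter> {..ys ! k})"
    proof (intro card_mono)
      show "set (take (Suc k) ys) \<subseteq> Y \<inter> {..ys ! k}"
      proof
        fix y assume "y \<in> set (take (Suc k) ys)"
        then obtain m where m: "m < Suc k" "y = ys ! m"
          by (auto simp: in_set_conv_nth)
        have "y \<le> ys ! k"
          using m sorted_wrt_nth_less[OF so(2), of m k] k len by (cases "m = k") auto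
        then show "y \<in> Y \<inter> {..ys ! k}"
          using m k len st by auto
      qed
    qed (use fin in auto)
    also have "\<dots> \<le> card (X \<inter> {..ys ! k})"
      by (rule le)
    also have "\<dots> \<le> card (set (take k xs))"
    proof (intro card_mono)
      show "X \<inter> {..ys ! k} \<subseteq> set (take k xs)"
      proof
        fix x assume x: "x \<in> X \<inter> {..ys ! k}"
        then obtain m where m: "m < card X" "x = xs ! m"
          using st len by (metis IntD1 in_set_conv_nth)
        have "m < k"
          using sorted_wrt_nth_less[OF so(1), of k m] m len x gt by (cases "m = k") force+
        then show "x \<in> set (take k xs)"
          using m len by (auto simp: in_set_conv_nth)
      qed
    qed auto
    also have "\<dots> \<le> k"
      using card_length[of "take k xs"] by simp
    finally show False
      by simp
  qed
  then show ?thesis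
    using len by (simp add: list_all2_conv_all_nth flip: xs_def ys_def)
qed

lemma valley_path_dyck:
  assumes n: "n \<ge> 1" and XY: "dyck_pair n X Y"
  shows "valley_path n X Y \<in> dyck n"
    and "SetX (valley_path n X Y) = X" and "SetY (valley_path n X Y) = Y"
proof -
  let ?xs = "sorted_list_of_set X" and ?ys = "sorted_list_of_set Y"
  have sub: "X \<subseteq> {1..n - 1}" "Y \<subseteq> {1..n - 1}" and card: "card X = card Y"
    and le: "\<And>t. card (Y \<inter> {..t}) \<le> card (X \<inter> {..t})"
    using XY by (auto simp: dyck_pair_def)
  have fin: "finite X" "finite Y"
    using sub by (auto intro: finite_subset)
  have len: "length ?xs = length ?ys"
    using card by simp
  have "sorted_wrt (<) (0 # ?xs @ [n])" "sorted_wrt (<) (0 # ?ys @ [n])"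
    using fin sub n by (fastforce simp: sorted_wrt_append)+
  moreover have "list_all2 (\<le>) (?xs @ [n]) (?ys @ [n])"
    using sorted_list_of_set_pointwise_le[OF fin card le] by (simp add: list_all2_appendI)
  ultimately have *: "valley_path n X Y \<in> dyck n" "valleys (valley_path n X Y) = set (zip ?xs ?ys)"
    using stair_props[of "?xs @ [n]" "?ys @ [n]"]
    by (auto simp: valley_path_def dyck_iff)
  show "valley_path n X Y \<in> dyck n"
    by (fact *)
  have "set (map fst (zip ?xs ?ys)) = X" "set (map snd (zip ?xs ?ys)) = Y"
    using len fin by (simp_all only: map_fst_zip map_snd_zip set_sorted_list_of_set)
  then show "SetX (valley_path n X Y) = X" "SetY (valley_path n X Y) = Y"
    by (simp_all add: SetX_def SetY_def *)
qed

section \<open>The involution on Dyck paths\<close>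

lemma dyck_pair_complement:
  assumes "dyck_pair n X Y"
  shows "dyck_pair n ({1..n - 1} - Y) ({1..n - 1} - X)"
proof -
  have sub: "X \<subseteq> {1..n - 1}" "Y \<subseteq> {1..n - 1}" and card: "card X = card Y"
    and le: "\<And>t. card (Y \<inter> {..t}) \<le> card (X \<inter> {..t})"
    using assms by (auto simp: dyck_pair_def)
  have eq: "card (({1..n - 1} - Z) \<inter> {..t}) = card ({1..n - 1} \<inter> {..t}) - card (Z \<inter> {..t})"
    if "Z \<subseteq> {1..n - 1}" for Z t
  proof -
    have "({1..n - 1} - Z) \<inter> {..t} = ({1..n - 1} \<inter> {..t}) - (Z \<inter> {..t})"
      by auto
    then show ?thesis
      using that by (simp only:) (intro card_Diff_subset, auto intro: finite_subset)
  qed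
  have "card ({1..n - 1} - Y) = card ({1..n - 1} - X)"
    using sub card by (simp add: card_Diff_subset finite_subset)
  then show ?thesis
    using le sub by (auto simp: dyck_pair_def eq diff_le_mono2 simp del: One_nat_def)
qed

lemma Psi_dyck:
  assumes n: "n \<ge> 1" and D: "D \<in> dyck n"
  shows "Psi n D \<in> dyck n \<and> SetX (Psi n D) = {1..n - 1} - SetY D \<and>
     SetY (Psi n D) = {1..n - 1} - SetX D"
  unfolding Psi_def
proof (rule theI')
  note vp = valley_path_dyck[OF n dyck_pair_complement[OF dyck_pair_valleys[OF D]]]
  show "\<exists>!D'. D' \<in> dyck n \<and> SetX D' = {1..n - 1} - SetY D \<and> SetY D' = {1..n - 1} - SetX D"
    using vp dyck_eqI by (intro ex1I) (blast, metis)
qed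

text \<open>
  Reflection of a path in the antidiagonal: the word is read backwards and its two letters are
  exchanged.
\<close>

definition flip_word :: "nat list \<Rightarrow> nat list" where
  "flip_word D = rev (map (\<lambda>a. 1 - a) D)"

lemma flip_word_flip_word: "set D \<subseteq> {0, 1} \<Longrightarrow> flip_word (flip_word D) = D"
  by (induction D) (auto simp: flip_word_def)

lemma flip_word_append: "flip_word (u @ v) = flip_word v @ flip_word u"
  by (simp add: flip_word_def)

lemma set_flip_word: "set (flip_word D) \<subseteq> {0, 1}"
  by (auto simp: flip_word_def)

lemma count_flip_word:
  assumes "set D \<subseteq> {0, 1}"
  shows "count_list (flip_word D) 0 = count_list D 1" "count_list (flip_word D) 1 = count_list D 0"
  using assms by (induction D) (auto simp: flip_word_def)

lemma flip_word_dyck: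
  assumes "D \<in> dyck n"
  shows "flip_word D \<in> dyck n"
proof -
  have D: "set D \<subseteq> {0, 1}" "count_list D 0 = n" "count_list D 1 = n" "ballot D"
    using assms by (auto simp: dyck_iff)
  have "count_list p 1 \<le> count_list p 0" if pq: "flip_word D = p @ q" for p q
  proof -
    have "D = flip_word q @ flip_word p"
      using pq D(1) by (metis flip_word_append flip_word_flip_word)
    then have "count_list (flip_word q) 1 \<le> count_list (flip_word q) 0"
      "count_list (flip_word q) 0 + count_list (flip_word p) 0 = n"
      "count_list (flip_word q) 1 + count_list (flip_word p) 1 = n"
      using D unfolding ballot_def by (blast, simp_all flip: count_list_append)
    moreover have "set p \<subseteq> {0, 1}"
      using set_flip_word[of D] pq by simp
    ultimately show ?thesis
      by (simp add: count_flip_word del: One_nat_def)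
  qed
  then show ?thesis
    using D set_flip_word[of D] 
    by (auto simp: dyck_iff ballot_def count_flip_word simp del: One_nat_def)
qed

lemma valleys_flip_word_subset:
  assumes "D \<in> dyck n" "(x, y) \<in> valleys D"
  shows "(n - y, n - x) \<in> valleys (flip_word D)"
proof -
  obtain p r where *: "D = p @ 1 # 0 # r" "x = Suc (count_list p 1)" "y = count_list p 0"
    using assms(2) by (auto simp: valleys_iff)
  have "flip_word D = flip_word r @ 1 # 0 # flip_word p"
    using * by (simp add: flip_word_def)
  moreover have "set r \<subseteq> {0, 1}" "count_list D 0 = n" "count_list D 1 = n"
    using assms(1) * by (auto simp: dyck_iff)
  ultimately show ?thesis
    unfolding valleys_iff using *
    by (intro exI[of _ "flip_word r"] exI[of _ "flip_word p"])
      (auto simp: count_flip_word simp del: One_nat_def)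
qed

lemma valleys_flip_word:
  assumes D: "D \<in> dyck n"
  shows "valleys (flip_word D) = (\<lambda>(i, j). (n - j, n - i)) ` valleys D"
proof (intro equalityI subsetI)
  fix v assume v: "v \<in> valleys (flip_word D)"
  obtain x y where xy: "v = (x, y)"
    by (cases v)
  have "(n - y, n - x) \<in> valleys D"
    using valleys_flip_word_subset[OF flip_word_dyck[OF D]] v xy D
    by (simp add: dyck_iff flip_word_flip_word)
  moreover have "x \<le> n" "y \<le> n"
    using dyck_valley_bounds[OF flip_word_dyck[OF D]] v xy by fastforce+
  ultimately show "v \<in> (\<lambda>(i, j). (n - j, n - i)) ` valleys D"
    using xy by (intro image_eqI[of _ _ "(n - y, n - x)"]) auto
qed (use valleys_flip_word_subset[OF D] in auto)

lemma flip_valleys_dyck: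
  assumes D: "D \<in> dyck n"
  shows "flip_valleys n D \<in> dyck n \<and>
    valleys (flip_valleys n D) = (\<lambda>(i, j). (n - j, n - i)) ` valleys D"
  unfolding flip_valleys_def
proof (rule theI')
  show "\<exists>!D'. D' \<in> dyck n \<and> valleys D' = (\<lambda>(i, j). (n - j, n - i)) ` valleys D"
    using flip_word_dyck[OF D] valleys_flip_word[OF D] dyck_eqI
    by (intro ex1I[of _ "flip_word D"]) (auto simp: SetX_def SetY_def)
qed

lemma image_diff_complement:
  fixes n :: nat
  assumes "A \<subseteq> {1..n - 1}"
  shows "(\<lambda>i. n - i) ` ({1..n - 1} - A) = {1..n - 1} - (\<lambda>i. n - i) ` A"
proof -
  have "(\<lambda>i. n - i) ` {1..n - 1} = {1..n - 1}"
  proof (intro equalityI subsetI)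
    fix i assume "i \<in> {1..n - 1}"
    then show "i \<in> (\<lambda>i. n - i) ` {1..n - 1}"
      by (intro image_eqI[of _ _ "n - i"]) auto
  qed auto
  moreover have "inj_on (\<lambda>i. n - i) {1..n - 1}"
    by (auto simp: inj_on_def)
  ultimately show ?thesis
    using assms by (simp add: inj_on_image_set_diff[of _ "{1..n - 1}"])
qed

lemma psi_dyck:
  assumes n: "n \<ge> 1" and D: "D \<in> dyck n"
  shows "psi n D \<in> dyck n"
    and "SetX (psi n D) = {1..n - 1} - (\<lambda>i. n - i) ` SetX D"
    and "SetY (psi n D) = {1..n - 1} - (\<lambda>i. n - i) ` SetY D"
proof -
  note P = Psi_dyck[OF n D]
  note F = flip_valleys_dyck[OF conjunct1[OF P]]
  have sub: "SetX D \<subseteq> {1..n - 1}" "SetY D \<subseteq> {1..n - 1}"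
    using dyck_pair_valleys[OF D] by (auto simp: dyck_pair_def)
  show "psi n D \<in> dyck n"
    using F by (simp add: psi_def)
  have "SetX (psi n D) = (\<lambda>i. n - i) ` SetY (Psi n D)"
    using F by (simp add: psi_def SetX_def SetY_def image_image case_prod_unfold)
  then show "SetX (psi n D) = {1..n - 1} - (\<lambda>i. n - i) ` SetX D"
    using P image_diff_complement[OF sub(1)] by simp
  have "SetY (psi n D) = (\<lambda>i. n - i) ` SetX (Psi n D)"
    using F by (simp add: psi_def SetX_def SetY_def image_image case_prod_unfold)
  then show "SetY (psi n D) = {1..n - 1} - (\<lambda>i. n - i) ` SetY D"
    using P image_diff_complement[OF sub(2)] by simp
qed

lemma reflect_complement_involution:
  fixes n :: nat
  assumes "A \<subseteq> {1..n - 1}"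
  shows "{1..n - 1} - (\<lambda>i. n - i) ` ({1..n - 1} - (\<lambda>i. n - i) ` A) = A"
proof -
  have "(\<lambda>i. n - i) ` (\<lambda>i. n - i) ` A = id ` A"
    unfolding image_image using assms by (intro image_cong) force+
  moreover have "(\<lambda>i. n - i) ` A \<subseteq> {1..n - 1}"
    using assms by fastforce
  ultimately show ?thesis
    using assms by (simp add: image_diff_complement double_diff del: One_nat_def)
qed

lemma psi_psi:
  assumes "n \<ge> 1" "D \<in> dyck n"
  shows "psi n (psi n D) = D"
  using assms dyck_pair_valleys[OF assms(2)]
  by (intro dyck_eqI[of _ n])
    (simp_all add: psi_dyck dyck_pair_def reflect_complement_involution del: One_nat_def)

section \<open>The valleys of Krattenthaler's path\<close>

lemma S132D:
  assumes "\<sigma> \<in> S132 n"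
  shows "\<sigma> permutes {1..n}"
    and "\<lbrakk>1 \<le> i; i < j; j < k; k \<le> n; \<sigma> i < \<sigma> k; \<sigma> k < \<sigma> j\<rbrakk> \<Longrightarrow> False"
  using assms by (auto simp: S132_def)

lemma hseq_ascent:
  assumes s: "\<sigma> \<in> S132 n" and i: "1 \<le> i" "i < n" and asc: "\<sigma> i < \<sigma> (i + 1)"
  shows "hseq n \<sigma> i = Suc (hseq n \<sigma> (i + 1))"
proof -
  have "{j. i < j \<and> j \<le> n \<and> \<sigma> j > \<sigma> i}
      = insert (i + 1) {j. i + 1 < j \<and> j \<le> n \<and> \<sigma> j > \<sigma> (i + 1)}"
  proof (intro equalityI subsetI)
    fix j assume j: "j \<in> {j. i < j \<and> j \<le> n \<and> \<sigma> j > \<sigma> i}"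
    show "j \<in> insert (i + 1) {j. i + 1 < j \<and> j \<le> n \<and> \<sigma> j > \<sigma> (i + 1)}"
    proof (cases "j = i + 1")
      case False
      then have ij: "i + 1 < j"
        using j by auto
      then have "\<sigma> j \<noteq> \<sigma> (i + 1)"
        by (simp add: inj_eq[OF permutes_inj[OF S132D(1)[OF s]]])
      moreover have "\<not> \<sigma> j < \<sigma> (i + 1)"
        using S132D(2)[OF s, of i "i + 1" j] i ij j by auto
      ultimately show ?thesis
        using ij j by auto
    qed auto
  qed (use i asc in auto)
  then show ?thesis
    by (simp add: hseq_def)
qed

lemma hseq_descent:
  assumes "i < n" "\<sigma> i > \<sigma> (i + 1)"
  shows "hseq n \<sigma> i \<le> hseq n \<sigma> (i + 1)"
  unfolding hseq_def
proof (intro card_mono)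
  show "{j. i < j \<and> j \<le> n \<and> \<sigma> j > \<sigma> i} \<subseteq> {j. i + 1 < j \<and> j \<le> n \<and> \<sigma> j > \<sigma> (i + 1)}"
  proof
    fix j assume j: "j \<in> {j. i < j \<and> j \<le> n \<and> \<sigma> j > \<sigma> i}"
    then have "j \<noteq> i + 1"
      using assms by auto
    then show "j \<in> {j. i + 1 < j \<and> j \<le> n \<and> \<sigma> j > \<sigma> (i + 1)}"
      using j assms by auto
  qed
qed auto

text \<open>
  The path after \<open>k\<close> letters of \<open>\<sigma>\<close> have been read. The valley produced by a descent at \<open>k\<close> itself
  appears only with the next letter, hence the condition \<open>i < k\<close>.
\<close>

lemma kappa_prefix:
  assumes s: "\<sigma> \<in> S132 n" and k: "1 \<le> k" "k \<le> n"
  defines "w \<equiv> \<lambda>k. foldl (\<lambda>w i. kappa_step w (hseq n \<sigma> i)) [] [1..<k + 1]"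
  shows "set (w k) \<subseteq> {0, 1} \<and> count_list (w k) 1 = k \<and> count_list (w k) 0 = k + hseq n \<sigma> k
    \<and> w k \<noteq> [] \<and> last (w k) = 1 \<and> ballot (w k)
    \<and> valleys (w k) = {(i, i + hseq n \<sigma> i) | i. i \<in> Des n \<sigma> \<and> i < k}"
  using k
proof (induction k rule: nat_induct_at_least)
  case base
  have w1: "w 1 = ([] @ replicate (Suc (hseq n \<sigma> 1)) 0) @ [1]"
    by (simp add: w_def kappa_step_def height_def nat_add_distrib flip: replicate_Suc)
  have "ballot []"
    by (simp add: ballot_def)
  then have "ballot (w 1)"
    unfolding w1 ballot_snoc ballot_north by (simp add: count_list_replicate)
  moreover have "valleys (w 1) = {}"
    unfolding w1 valleys_snoc valleys_north by simp
  ultimately show ?case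
    unfolding w1 by (auto simp: count_list_replicate Des_def)
next
  case (Suc k)
  note IH = Suc.IH[OF Suc_leD[OF Suc.prems]]
  let ?m = "Suc (hseq n \<sigma> (Suc k)) - hseq n \<sigma> k"
  have k: "1 \<le> k" "k < n"
    using Suc by auto
  have "\<sigma> k \<noteq> \<sigma> (k + 1)"
    by (simp add: inj_eq[OF permutes_inj[OF S132D(1)[OF s]]])
  then have h: "hseq n \<sigma> k \<le> Suc (hseq n \<sigma> (Suc k))" "0 < ?m \<longleftrightarrow> k \<in> Des n \<sigma>"
    using hseq_ascent[OF s k] hseq_descent[OF k(2), of \<sigma>] k
    by (cases "\<sigma> k < \<sigma> (k + 1)"; simp add: Des_def)+
  have "w (Suc k) = kappa_step (w k) (hseq n \<sigma> (Suc k))"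
    by (simp add: w_def)
  also have "\<dots> = (w k @ replicate ?m 0) @ [1]"
    using IH h(1) by (simp add: kappa_step_def height_def nat_diff_distrib' del: One_nat_def)
  finally have wS: "w (Suc k) = (w k @ replicate ?m 0) @ [1]" .
  have "ballot (w (Suc k))"
    unfolding wS ballot_snoc ballot_north using IH h(1) by (simp add: count_list_replicate)
  moreover have "valleys (w (Suc k)) = {(i, i + hseq n \<sigma> i) | i. i \<in> Des n \<sigma> \<and> i < Suc k}"
    unfolding wS valleys_snoc valleys_north using IH h(2) by (auto simp: less_Suc_eq)
  ultimately show ?case
    unfolding wS using IH h(1) by (auto simp: count_list_replicate)
qed

lemma kappa_dyck:
  assumes n: "n \<ge> 1" and s: "\<sigma> \<in> S132 n"
  shows "kappa n \<sigma> \<in> dyck n"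
    and "valleys (kappa n \<sigma>) = (\<lambda>i. (i, i + hseq n \<sigma> i)) ` Des n \<sigma>"
proof -
  have "hseq n \<sigma> n = 0"
    by (simp add: hseq_def)
  then show "kappa n \<sigma> \<in> dyck n"
    "valleys (kappa n \<sigma>) = (\<lambda>i. (i, i + hseq n \<sigma> i)) ` Des n \<sigma>"
    using kappa_prefix[OF s n order_refl] by (auto simp: dyck_iff kappa_def Des_def)
qed

text \<open>
  The positions to the right of \<open>i\<close> that carry a value smaller than \<open>\<sigma> i\<close>.
\<close>

definition later_smaller :: "nat \<Rightarrow> (nat \<Rightarrow> nat) \<Rightarrow> nat \<Rightarrow> nat set" where
  "later_smaller n \<sigma> i = {j. i < j \<and> j \<le> n \<and> \<sigma> j < \<sigma> i}"

lemma finite_later_smaller: "finite (later_smaller n \<sigma> i)"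
  by (rule finite_subset[of _ "{..n}"]) (auto simp: later_smaller_def)

lemma hseq_later_smaller:
  assumes p: "\<sigma> permutes {1..n}" and i: "i \<le> n"
  shows "i + hseq n \<sigma> i + card (later_smaller n \<sigma> i) = n"
proof -
  have "\<sigma> j \<noteq> \<sigma> i" if "i < j" for j
    using that by (simp add: inj_eq[OF permutes_inj[OF p]])
  then have "{i<..n} = {j. i < j \<and> j \<le> n \<and> \<sigma> j > \<sigma> i} \<union> later_smaller n \<sigma> i"
    by (auto simp: later_smaller_def) (metis linorder_less_linear)
  then have "card {i<..n} = card ({j. i < j \<and> j \<le> n \<and> \<sigma> j > \<sigma> i} \<union> later_smaller n \<sigma> i)"
    by simp
  also have "\<dots> = hseq n \<sigma> i + card (later_smaller n \<sigma> i)"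
    unfolding hseq_def
    by (intro card_Un_disjoint finite_later_smaller) (auto simp: later_smaller_def)
  finally show ?thesis
    using i by simp
qed

text \<open>
  If \<open>i\<close> is a descent, the values at the later smaller positions are \<open>1, \<dots>, c\<close>,
  where \<open>c\<close> is their number: a value \<open>u\<close> at or
  before \<open>i\<close> and below such a value \<open>v\<close> would give the pattern 132 formed by \<open>u\<close>, \<open>\<sigma> i\<close>, \<open>v\<close>. Hence
  \<open>c\<close> stands to the right of \<open>i\<close> and \<open>c + 1\<close> does not.
\<close>

lemma later_smaller_in_iDes:
  assumes s: "\<sigma> \<in> S132 n" and i: "i \<in> Des n \<sigma>"
  shows "card (later_smaller n \<sigma> i) \<in> iDes n \<sigma>"
proof -
  note p = S132D(1)[OF s]
  have i': "1 \<le> i" "i < n" "\<sigma> (i + 1) < \<sigma> i"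
    using i by (auto simp: Des_def)
  define V where "V = \<sigma> ` later_smaller n \<sigma> i"
  have V: "u \<in> V \<longleftrightarrow> 1 \<le> u \<and> u < \<sigma> i \<and> i < inv \<sigma> u" for u
  proof
    assume "u \<in> V"
    then obtain j where j: "i < j" "j \<le> n" "\<sigma> j < \<sigma> i" "u = \<sigma> j"
      by (auto simp: V_def later_smaller_def)
    then have "\<sigma> j \<in> {1..n}"
      using permutes_in_image[OF p, of j] i' by simp
    then show "1 \<le> u \<and> u < \<sigma> i \<and> i < inv \<sigma> u"
      using j permutes_inverses(2)[OF p] by simp
  next
    assume u: "1 \<le> u \<and> u < \<sigma> i \<and> i < inv \<sigma> u"
    have "\<sigma> i \<in> {1..n}"
      using permutes_in_image[OF p, of i] i' by simp
    then have "inv \<sigma> u \<in> {1..n}"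
      using permutes_in_image[OF permutes_inv[OF p], of u] u by simp
    then show "u \<in> V"
      unfolding V_def later_smaller_def using u permutes_inverses(1)[OF p]
      by (intro image_eqI[of _ _ "inv \<sigma> u"]) auto
  qed
  have down: "u \<in> V" if v: "v \<in> V" and u: "1 \<le> u" "u < v" for u v
  proof (rule ccontr)
    assume "u \<notin> V"
    then have le: "inv \<sigma> u \<le> i"
      using V v u by fastforce
    have "u \<noteq> \<sigma> i"
      using V v u by fastforce
    then have "inv \<sigma> u \<noteq> i"
      using permutes_inverses(1)[OF p] by metis
    moreover have vn: "\<sigma> (inv \<sigma> u) = u" "\<sigma> (inv \<sigma> v) = v"
      using permutes_inverses(1)[OF p] by auto
    moreover have "\<sigma> i \<in> {1..n}"
      using permutes_in_image[OF p, of i] i' by simp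
    then have "u \<in> {1..n}" "v \<in> {1..n}"
      using u v V by fastforce+
    then have "inv \<sigma> u \<in> {1..n}" "inv \<sigma> v \<in> {1..n}"
      using permutes_in_image[OF permutes_inv[OF p]] by blast+
    ultimately show False
      using S132D(2)[OF s, of "inv \<sigma> u" i "inv \<sigma> v"] le V[of v] v u by auto
  qed
  define c where "c = card (later_smaller n \<sigma> i)"
  have fin: "finite V"
    by (simp add: V_def finite_later_smaller)
  have "i + 1 \<in> later_smaller n \<sigma> i"
    using i' by (simp add: later_smaller_def)
  then have ne: "V \<noteq> {}"
    by (auto simp: V_def)
  have "V = {1..Max V}"
  proof (intro equalityI subsetI)
    fix u assume "u \<in> {1..Max V}"
    then show "u \<in> V"
      using down[OF Max_in[OF fin ne], of u] Max_in[OF fin ne] by (cases "u = Max V") auto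
  qed (use V fin in auto)
  then have "card V = Max V"
    by (metis card_atLeastAtMost diff_Suc_1)
  moreover have "card V = c"
    unfolding V_def c_def using permutes_inj[OF p] by (intro card_image) (auto simp: inj_on_def)
  ultimately have cV: "c \<in> V" "c + 1 \<notin> V"
    using Max_in[OF fin ne] Max_ge[OF fin, of "c + 1"] by auto
  have lt: "1 \<le> c" "c < \<sigma> i" "i < inv \<sigma> c"
    using cV(1) V by auto
  have "inv \<sigma> (c + 1) \<le> i"
  proof (cases "c + 1 = \<sigma> i")
    case True
    then show ?thesis
      using permutes_inverses(2)[OF p] by simp
  next
    case False
    then show ?thesis
      using cV(2) lt by (simp add: V)
  qed
  moreover have "\<sigma> i \<le> n"
    using permutes_in_image[OF p, of i] i' by simp
  ultimately show ?thesis
    using lt by (simp add: iDes_def Des_def flip: c_def)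
qed

text \<open>
  Let \<open>v + 1\<close> stand to the left of \<open>v\<close>. The required descent is the last position \<open>i\<close> before that of
  \<open>v\<close> carrying a value above \<open>v\<close>; by avoidance of 132 the later smaller values are \<open>1, \<dots>, v\<close>.
\<close>

lemma iDes_later_smaller:
  assumes s: "\<sigma> \<in> S132 n" and v: "v \<in> iDes n \<sigma>"
  shows "\<exists>i \<in> Des n \<sigma>. card (later_smaller n \<sigma> i) = v"
proof -
  note p = S132D(1)[OF s]
  note inv1 = permutes_inverses(1)[OF p] and inv2 = permutes_inverses(2)[OF p]
  have v': "1 \<le> v" "v < n" "inv \<sigma> (v + 1) < inv \<sigma> v"
    using v by (auto simp: iDes_def Des_def)
  have inr: "inv \<sigma> u \<in> {1..n} \<longleftrightarrow> u \<in> {1..n}" for u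
    using permutes_in_image[OF permutes_inv[OF p]] .
  define q where "q = inv \<sigma> v"
  define a where "a = inv \<sigma> (v + 1)"
  have q: "1 \<le> q" "q \<le> n" "\<sigma> q = v"
    using inr[of v] v' inv1 by (auto simp: q_def)
  have a: "1 \<le> a" "a < q" "\<sigma> a = v + 1"
    using inr[of "v + 1"] v' inv1 by (auto simp: q_def a_def)
  define P where "P = {j. 1 \<le> j \<and> j < q \<and> v < \<sigma> j}"
  have "finite P"
    by (rule finite_subset[of _ "{..<q}"]) (auto simp: P_def)
  moreover have "a \<in> P"
    using a by (simp add: P_def)
  ultimately obtain i where i: "i \<in> P" and max: "\<And>j. j \<in> P \<Longrightarrow> j \<le> i"
    using Max_in[of P] Max_ge[of P] by blast
  have i': "1 \<le> i" "i < q" "v < \<sigma> i" and ai: "a \<le> i"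
    using i max[OF \<open>a \<in> P\<close>] by (auto simp: P_def)
  have "\<sigma> (i + 1) \<le> v"
  proof (rule ccontr)
    assume "\<not> \<sigma> (i + 1) \<le> v"
    then have "i + 1 \<in> P"
      using q i' by (cases "i + 1 = q") (auto simp: P_def)
    then show False
      using max by fastforce
  qed
  then have des: "i \<in> Des n \<sigma>"
    using i' q by (simp add: Des_def)
  have "later_smaller n \<sigma> i = inv \<sigma> ` {1..v}"
  proof (intro equalityI subsetI)
    fix j assume "j \<in> later_smaller n \<sigma> i"
    then have j: "i < j" "j \<le> n" "\<sigma> j < \<sigma> i"
      by (auto simp: later_smaller_def)
    have "\<sigma> j \<le> v"
    proof (rule ccontr)
      assume "\<not> \<sigma> j \<le> v"
      moreover have "\<sigma> j \<noteq> v + 1"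
        using a ai j inv2[of j] inv2[of a] by auto
      ultimately have *: "v + 1 < \<sigma> j"
        by simp
      then have "a \<noteq> i"
        using a j by auto
      \<comment> \<open>The values \<open>v + 1\<close>, \<open>\<sigma> i\<close>, \<open>\<sigma> j\<close> at \<open>a < i < j\<close> form the pattern 132.\<close>
      then show False
        using S132D(2)[OF s, of a i j] a ai j * by simp
    qed
    moreover have "1 \<le> \<sigma> j"
      using permutes_in_image[OF p, of j] j i' by simp
    ultimately show "j \<in> inv \<sigma> ` {1..v}"
      using inv2[of j] by (intro image_eqI[of _ _ "\<sigma> j"]) auto
  next
    fix j assume "j \<in> inv \<sigma> ` {1..v}"
    then obtain u where u: "1 \<le> u" "u \<le> v" "j = inv \<sigma> u"
      by auto
    then have j: "\<sigma> j = u" "1 \<le> j" "j \<le> n"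
      using inv1 inr[of u] v' by auto
    \<comment> \<open>Otherwise \<open>u\<close>, \<open>\<sigma> i\<close>, \<open>v\<close> at the positions \<open>j\<close>, \<open>i\<close>, \<open>q\<close> form the pattern 132.\<close>
    have "i < j"
    proof (rule ccontr)
      assume "\<not> i < j"
      moreover have "j \<noteq> i" "u \<noteq> v"
        using calculation i' j u q_def by auto
      ultimately show False
        using S132D(2)[OF s, of j i q] j i' q u by auto
    qed
    then show "j \<in> later_smaller n \<sigma> i"
      using j u i' by (simp add: later_smaller_def)
  qed
  then have "card (later_smaller n \<sigma> i) = v"
    using permutes_inj[OF permutes_inv[OF p]] by (simp add: card_image inj_on_subset)
  then show ?thesis
    using des by blast
qed

lemma SetX_kappa:
  assumes "n \<ge> 1" "\<sigma> \<in> S132 n"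
  shows "SetX (kappa n \<sigma>) = Des n \<sigma>"
  using kappa_dyck[OF assms] by (simp add: SetX_def image_image)

lemma SetY_kappa:
  assumes n: "n \<ge> 1" and s: "\<sigma> \<in> S132 n"
  shows "SetY (kappa n \<sigma>) = (\<lambda>v. n - v) ` iDes n \<sigma>"
proof -
  have "SetY (kappa n \<sigma>) = (\<lambda>i. i + hseq n \<sigma> i) ` Des n \<sigma>"
    using kappa_dyck[OF n s] by (simp add: SetY_def image_image)
  also have "\<dots> = (\<lambda>i. n - card (later_smaller n \<sigma> i)) ` Des n \<sigma>"
  proof (intro image_cong refl)
    fix i assume "i \<in> Des n \<sigma>"
    then show "i + hseq n \<sigma> i = n - card (later_smaller n \<sigma> i)"
      using hseq_later_smaller[OF S132D(1)[OF s], of i] by (simp add: Des_def)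
  qed
  also have "\<dots> = (\<lambda>v. n - v) ` (\<lambda>i. card (later_smaller n \<sigma> i)) ` Des n \<sigma>"
    by (simp add: image_image)
  also have "(\<lambda>i. card (later_smaller n \<sigma> i)) ` Des n \<sigma> = iDes n \<sigma>"
    using later_smaller_in_iDes[OF s] iDes_later_smaller[OF s] by blast
  finally show ?thesis .
qed

section \<open>Reversal\<close>

lemma rho_permutes:
  assumes p: "\<sigma> permutes {1..n}"
  shows "rho n \<sigma> permutes {1..n}"
proof -
  have "bij_betw (\<lambda>i. n + 1 - i) {1..n} {1..n}"
    by (rule bij_betwI[where g = "\<lambda>i. n + 1 - i"]) auto
  then have "bij_betw (\<sigma> \<circ> (\<lambda>i. n + 1 - i)) {1..n} {1..n}"
    using permutes_imp_bij[OF p] by (rule bij_betw_trans)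
  then have "bij_betw (rho n \<sigma>) {1..n} {1..n}"
    by (rule bij_betw_cong[THEN iffD1, rotated]) (simp add: rho_def)
  then show ?thesis
    by (rule bij_imp_permutes) (auto simp: rho_def)
qed

lemma rho_rho: "\<sigma> permutes {1..n} \<Longrightarrow> rho n (rho n \<sigma>) = \<sigma>"
  by (auto simp: rho_def fun_eq_iff permutes_not_in)

lemma rho_S132:
  assumes s: "\<sigma> \<in> S132 n"
  shows "rho n \<sigma> \<in> S231 n"
proof -
  have False if "1 \<le> i" "i < j" "j < k" "k \<le> n" "rho n \<sigma> k < rho n \<sigma> i" "rho n \<sigma> i < rho n \<sigma> j"
    for i j k
  proof -
    have "1 \<le> n + 1 - k" "n + 1 - k < n + 1 - j" "n + 1 - j < n + 1 - i" "n + 1 - i \<le> n"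
      using that by linarith+
    then show False
      using S132D(2)[OF s, of "n + 1 - k" "n + 1 - j" "n + 1 - i"] that by (simp add: rho_def)
  qed
  then show ?thesis
    using rho_permutes[OF S132D(1)[OF s]] by (auto simp: S231_def)
qed

lemma rho_S231:
  assumes s: "\<sigma> \<in> S231 n"
  shows "rho n \<sigma> \<in> S132 n"
proof -
  have p: "\<sigma> permutes {1..n}"
    and av: "\<And>i j k. \<lbrakk>1 \<le> i; i < j; j < k; k \<le> n; \<sigma> k < \<sigma> i; \<sigma> i < \<sigma> j\<rbrakk> \<Longrightarrow> False"
    using s by (auto simp: S231_def)
  have False if "1 \<le> i" "i < j" "j < k" "k \<le> n" "rho n \<sigma> i < rho n \<sigma> k" "rho n \<sigma> k < rho n \<sigma> j"
    for i j k
  proof -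
    have "1 \<le> n + 1 - k" "n + 1 - k < n + 1 - j" "n + 1 - j < n + 1 - i" "n + 1 - i \<le> n"
      using that by linarith+
    then show False
      using av[of "n + 1 - k" "n + 1 - j" "n + 1 - i"] that by (simp add: rho_def)
  qed
  then show ?thesis
    using rho_permutes[OF p] by (auto simp: S132_def)
qed

lemma Des_rho:
  assumes p: "\<sigma> permutes {1..n}"
  shows "Des n (rho n \<sigma>) = {1..n - 1} - (\<lambda>i. n - i) ` Des n \<sigma>"
proof (intro set_eqI)
  fix i
  show "i \<in> Des n (rho n \<sigma>) \<longleftrightarrow> i \<in> {1..n - 1} - (\<lambda>i. n - i) ` Des n \<sigma>"
  proof (cases "1 \<le> i \<and> i < n")
    case True
    then have "i \<in> (\<lambda>i. n - i) ` Des n \<sigma> \<longleftrightarrow> n - i \<in> Des n \<sigma>"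
      by (auto simp: Des_def image_iff intro!: exI[of _ "n - i"])
    moreover have "rho n \<sigma> i = \<sigma> (n - i + 1)" "rho n \<sigma> (i + 1) = \<sigma> (n - i)"
      using True by (auto simp: rho_def Suc_diff_le)
    moreover have "\<sigma> (n - i) \<noteq> \<sigma> (n - i + 1)"
      by (simp add: inj_eq[OF permutes_inj[OF p]])
    ultimately show ?thesis
      using True by (auto simp: Des_def)
  qed (auto simp: Des_def)
qed

lemma inv_rho:
  assumes p: "\<sigma> permutes {1..n}" and i: "i \<in> {1..n}"
  shows "inv (rho n \<sigma>) i = n + 1 - inv \<sigma> i"
proof -
  have "inv \<sigma> i \<in> {1..n}"
    using permutes_in_image[OF permutes_inv[OF p]] i by blast
  then have "rho n \<sigma> (n + 1 - inv \<sigma> i) = i"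
    using permutes_inverses(1)[OF p] by (auto simp: rho_def)
  then show ?thesis
    using permutes_inverses(2)[OF rho_permutes[OF p]] by metis
qed

lemma iDes_rho:
  assumes p: "\<sigma> permutes {1..n}"
  shows "iDes n (rho n \<sigma>) = {1..n - 1} - iDes n \<sigma>"
proof (intro set_eqI)
  fix i
  show "i \<in> iDes n (rho n \<sigma>) \<longleftrightarrow> i \<in> {1..n - 1} - iDes n \<sigma>"
  proof (cases "1 \<le> i \<and> i < n")
    case True
    then have "inv \<sigma> i \<in> {1..n}" "inv \<sigma> (i + 1) \<in> {1..n}"
      using permutes_in_image[OF permutes_inv[OF p]] by auto
    moreover have "inv \<sigma> i \<noteq> inv \<sigma> (i + 1)"
      by (simp add: inj_eq[OF permutes_inj[OF permutes_inv[OF p]]])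
    ultimately show ?thesis
      using True by (auto simp: iDes_def Des_def inv_rho[OF p])
  qed (auto simp: iDes_def Des_def)
qed

text \<open>
  That \<open>Des\<close> and \<open>iDes\<close> of the reversed permutation form a \<open>dyck_pair\<close> is read off from the path
  \<open>\<psi>(\<kappa>(\<sigma>))\<close>, which has them as its sets of valley coordinates.
\<close>

lemma Phi_rho:
  assumes n: "n \<ge> 1" and s: "\<sigma> \<in> S132 n"
  shows "Phi n (rho n \<sigma>) = psi n (kappa n \<sigma>)"
proof -
  note K = kappa_dyck(1)[OF n s] and p = S132D(1)[OF s]
  note psi = psi_dyck[OF n K]
  have X: "SetX (psi n (kappa n \<sigma>)) = Des n (rho n \<sigma>)"
    using psi(2) by (simp only: SetX_kappa[OF n s] Des_rho[OF p])
  have "(\<lambda>i. n - i) ` (\<lambda>v. n - v) ` iDes n \<sigma> = id ` iDes n \<sigma>"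
    unfolding image_image by (intro image_cong) (auto simp: iDes_def Des_def)
  then have Y: "SetY (psi n (kappa n \<sigma>)) = iDes n (rho n \<sigma>)"
    using psi(3) by (simp only: SetY_kappa[OF n s] iDes_rho[OF p] image_id id_apply)
  have "dyck_pair n (Des n (rho n \<sigma>)) (iDes n (rho n \<sigma>))"
    using dyck_pair_valleys[OF psi(1)] by (simp only: X Y)
  note vp = valley_path_dyck[OF n this]
  show ?thesis
    unfolding Phi_eq_valley_path using vp X Y by (intro dyck_eqI[OF _ psi(1)]) simp_all
qed

theorem theorem5p6:
  fixes n :: nat
  assumes "n \<ge> 1"
  shows "kappa n \<in> S132 n \<rightarrow> dyck n \<and>
     rho n \<in> S132 n \<rightarrow> S231 n \<and>
     Phi n \<in> S231 n \<rightarrow> dyck n \<and>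
     psi n \<in> dyck n \<rightarrow> dyck n \<and>
     (\<forall>\<sigma> \<in> S132 n. kappa n \<sigma> = (psi n \<circ> Phi n \<circ> rho n) \<sigma>)"
proof (intro conjI funcsetI ballI)
  fix \<sigma> assume s: "\<sigma> \<in> S132 n"
  show "kappa n \<sigma> \<in> dyck n"
    using kappa_dyck(1)[OF assms s] .
  show "rho n \<sigma> \<in> S231 n"
    using rho_S132[OF s] .
  show "kappa n \<sigma> = (psi n \<circ> Phi n \<circ> rho n) \<sigma>"
    by (simp add: Phi_rho[OF assms s] psi_psi[OF assms kappa_dyck(1)[OF assms s]])
next
  fix \<tau> assume t: "\<tau> \<in> S231 n"
  have "rho n \<tau> \<in> S132 n"
    using rho_S231[OF t] .
  then have "psi n (kappa n (rho n \<tau>)) \<in> dyck n"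
    "Phi n (rho n (rho n \<tau>)) = psi n (kappa n (rho n \<tau>))"
    using psi_dyck(1)[OF assms kappa_dyck(1)[OF assms]] Phi_rho[OF assms] by auto
  then show "Phi n \<tau> \<in> dyck n"
    using t by (simp add: rho_rho S231_def)
next
  fix D assume "D \<in> dyck n"
  then show "psi n D \<in> dyck n"
    using psi_dyck(1)[OF assms] by blast
qed

end
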